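(* Let $l(x)=(-x)^+$. Assume that $\mathbb P=\mathbb Q$, $\alpha_1,\ldots,\alpha_n\geq 0$ and that the process $(S_k)_{k=0}^n$ is non-decreasing. Then $$V_0^{EU}=\max_{k\in\{1,\ldots,n\}}\{\mathbb E[S_k]-\alpha_k\}.$$
   Context: Setting: $(\Omega,\mathcal F,\mathbb P)$ is a probability space with a discrete filtration $\mathbb F=(\mathcal F_k)_{k=0}^n$, $n\ge 1$, with $\mathcal F_0$ trivial; $\mathbb Q$ is a probability measure equivalent to $\mathbb P$; $S_0=0$ and $S_k=P_1+\dots+P_k$, where each $P_i$ is $\mathcal F_i$-measurable with $\mathbb E^{\mathbb Q}[|P_i|]<\infty$. Here $x^+=\max(x,0)$. When $\mathbb P=\mathbb Q$, $\mathbb E$ denotes the common expectation. $V_0^{EU}=V_0^{EU}(\alpha_1,\ldots,\alpha_n)$ is the infimum of $M_0$ over all $\mathbb Q$-supermartingales $(M_k)_{k=0}^n$ with respect to $\mathbb F$ such that $\mathbb E^{\mathbb P}[l(M_k-S_k)]\leq\alpha_k$ for $k=1,\ldots,n$. *)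

theory Defs
  imports "HOL-Probability.Probability"
begin

definition equivalent_measure :: "'a measure \<Rightarrow> 'a measure \<Rightarrow> bool" where
  "equivalent_measure P Q \<longleftrightarrow>
     sets Q = sets P \<and> absolutely_continuous P Q \<and> absolutely_continuous Q P"

text \<open>A filtration with finite horizon: \<open>F k\<close> is only constrained (and only used) for
  \<open>k \<le> n\<close>. Of the measures \<open>F k\<close> only the \<open>\<sigma>\<close>-algebra matters.\<close>

definition finite_filtration :: "'a measure \<Rightarrow> nat \<Rightarrow> (nat \<Rightarrow> 'a measure) \<Rightarrow> bool" where
  "finite_filtration P n F \<longleftrightarrow>
     (\<forall>k\<le>n. subalgebra P (F k)) \<and> (\<forall>j k. j \<le> k \<and> k \<le> n \<longrightarrow> sets (F j) \<subseteq> sets (F k))"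

text \<open>Triviality up to null sets; this includes the case \<open>sets F = {{}, space P}\<close>.\<close>

definition trivial_algebra :: "'a measure \<Rightarrow> 'a measure \<Rightarrow> bool" where
  "trivial_algebra P G \<longleftrightarrow> (\<forall>A\<in>sets G. measure P A = 0 \<or> measure P A = 1)"

definition supermartingale ::
    "'a measure \<Rightarrow> nat \<Rightarrow> (nat \<Rightarrow> 'a measure) \<Rightarrow> (nat \<Rightarrow> 'a \<Rightarrow> real) \<Rightarrow> bool" where
  "supermartingale Q n F M \<longleftrightarrow>
     (\<forall>k\<le>n. M k \<in> borel_measurable (F k) \<and> integrable Q (M k)) \<and>
     (\<forall>j k. j \<le> k \<and> k \<le> n \<longrightarrow> (AE \<omega> in Q. real_cond_exp Q (F j) (M k) \<omega> \<le> M j \<omega>))"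

text \<open>The expectation \<open>E[X\<^sup>+] - E[X\<^sup>-]\<close> with values in the extended reals (and
  \<open>\<infinity> - \<infinity> = \<infinity>\<close>). The Bochner integral would return 0 for a loss of infinite expectation and
  thereby admit it.\<close>

definition ext_expectation :: "'a measure \<Rightarrow> ('a \<Rightarrow> real) \<Rightarrow> ereal" where
  "ext_expectation P X =
     enn2ereal (\<integral>\<^sup>+\<omega>. ennreal (X \<omega>) \<partial>P) - enn2ereal (\<integral>\<^sup>+\<omega>. ennreal (- X \<omega>) \<partial>P)"

definition cumulative :: "(nat \<Rightarrow> 'a \<Rightarrow> real) \<Rightarrow> nat \<Rightarrow> 'a \<Rightarrow> real" where
  "cumulative p k \<omega> = (\<Sum>i=1..k. p i \<omega>)"

text \<open>Since \<open>F 0\<close> is trivial, \<open>M 0\<close> is almost surely equal to a constant \<open>c\<close>, the initial value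
  over which the infimum is taken. It is an infimum in \<open>ereal\<close>, where \<open>Inf {} = \<infinity>\<close> and
  sets without lower bound have infimum \<open>-\<infinity>\<close>.\<close>

definition V0_EU ::
    "'a measure \<Rightarrow> 'a measure \<Rightarrow> nat \<Rightarrow> (nat \<Rightarrow> 'a measure) \<Rightarrow> (real \<Rightarrow> real) \<Rightarrow>
     (nat \<Rightarrow> 'a \<Rightarrow> real) \<Rightarrow> (nat \<Rightarrow> real) \<Rightarrow> ereal" where
  "V0_EU P Q n F l S \<alpha> =
     Inf {ereal c | c M.
            supermartingale Q n F M \<and> (AE \<omega> in Q. M 0 \<omega> = c) \<and>
            (\<forall>k\<in>{1..n}. ext_expectation P (\<lambda>\<omega>. l (M k \<omega> - S k \<omega>)) \<le> ereal (\<alpha> k))}"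

end

theory Submission
  imports Defs
begin

text \<open>A supermartingale started at \<open>c\<close> satisfies \<open>c \<ge> E[M\<^sub>k] \<ge> E[S\<^sub>k] - E[(S\<^sub>k - M\<^sub>k)\<^sup>+]\<close>, which gives
  the lower bound. Conversely let \<open>c\<close> be the maximum, so \<open>c \<le> E[S\<^sub>n]\<close>. If \<open>c < 0\<close>, the constant \<open>c\<close>
  lies below all \<open>S\<^sub>k\<close>. Otherwise \<open>E[S\<^sub>j] \<le> c \<le> E[S\<^bsub>j+1\<^esub>]\<close> for some \<open>j\<close>, and \<open>c\<close> is the expectation of a
  convex combination \<open>Y\<close> of \<open>S\<^sub>j\<close> and \<open>S\<^bsub>j+1\<^esub>\<close>. The martingale \<open>M\<^sub>k = E[Y | F\<^sub>k]\<close> dominates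
  \<open>S\<^sub>k\<close> for \<open>k \<le> j\<close> and equals \<open>Y \<le> S\<^sub>k\<close> for \<open>k > j\<close>, so the expected shortfall at time \<open>k\<close> is
  \<open>0\<close> in the first case and \<open>E[S\<^sub>k] - c\<close> in the second.\<close>

section \<open>Expectations: extended values and trivial \<sigma>-algebras\<close>

lemma ext_expectation_eq_integral:
  assumes "integrable P X"
  shows "ext_expectation P X = ereal (\<integral>\<omega>. X \<omega> \<partial>P)"
proof -
  have "(\<integral>\<^sup>+\<omega>. ennreal (X \<omega>) \<partial>P) \<noteq> \<infinity>" "(\<integral>\<^sup>+\<omega>. ennreal (- X \<omega>) \<partial>P) \<noteq> \<infinity>"
    using assms by (auto simp: real_integrable_def)
  then obtain a b where ab: "0 \<le> a" "(\<integral>\<^sup>+\<omega>. ennreal (X \<omega>) \<partial>P) = ennreal a"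
    "0 \<le> b" "(\<integral>\<^sup>+\<omega>. ennreal (- X \<omega>) \<partial>P) = ennreal b"
    by (metis ennreal_cases infinity_ennreal_def)
  then have "(\<integral>\<omega>. X \<omega> \<partial>P) = a - b"
    using real_lebesgue_integral_def[OF assms] by simp
  then show ?thesis
    using ab by (simp add: ext_expectation_def)
qed

text \<open>The sets where \<open>f\<close> lies strictly below or strictly above its mean have
  probability 0 or 1. Probability 1 is impossible, because an almost sure strict inequality would
  pass to the mean itself.\<close>

lemma (in prob_space) AE_eq_expectation_of_trivial:
  fixes f :: "'a \<Rightarrow> real"
  assumes G: "subalgebra M G" and triv: "trivial_algebra M G"
    and meas: "f \<in> borel_measurable G" and int: "integrable M f"
  shows "AE \<omega> in M. f \<omega> = expectation f"
proof -
  have null: "AE \<omega> in M. \<omega> \<notin> A" if "A \<in> sets G" "prob A \<noteq> 1" for A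
    using that triv G
    by (intro AE_not_in) (auto simp: trivial_algebra_def subalgebra_def null_sets_def emeasure_eq_measure)
  let ?A = "{\<omega> \<in> space G. f \<omega> < expectation f}" and ?B = "{\<omega> \<in> space G. expectation f < f \<omega>}"
  have sets: "?A \<in> sets G" "?B \<in> sets G"
    using meas by measurable
  have ev: "?A \<in> events" "?B \<in> events"
    using sets G by (auto simp: subalgebra_def)
  have "prob ?A \<noteq> 1"
  proof
    assume "prob ?A = 1"
    then have "AE \<omega> in M. f \<omega> < expectation f"
      using prob_eq_1[OF ev(1)] by auto
    then show False
      using expectation_less[OF int, of "expectation f"] by simp
  qed
  moreover have "prob ?B \<noteq> 1"
  proof
    assume "prob ?B = 1"
    then have "AE \<omega> in M. expectation f < f \<omega>"
      using prob_eq_1[OF ev(2)] by auto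
    then show False
      using expectation_greater[OF int, of "expectation f"] by simp
  qed
  ultimately have "AE \<omega> in M. \<omega> \<notin> ?A" "AE \<omega> in M. \<omega> \<notin> ?B"
    using null sets by blast+
  then show ?thesis
    using AE_space
  proof eventually_elim
    case (elim \<omega>)
    moreover have "\<omega> \<in> space G"
      using elim G by (simp add: subalgebra_def)
    ultimately show ?case by auto
  qed
qed

section \<open>Supermartingales and the lower bound for the initial value\<close>

lemma (in prob_space) sigma_finite_subalgebra_filtration:
  assumes "finite_filtration M n F" and "k \<le> n"
  shows "sigma_finite_subalgebra M (F k)"
proof -
  have "finite_measure_subalgebra M (F k)"
    using assms by unfold_locales (auto simp: finite_filtration_def)
  then interpret finite_measure_subalgebra M "F k" .
  show ?thesis
    by unfold_locales
qed

lemma (in prob_space) subalgebra_filtration: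
  assumes "finite_filtration M n F" and "j \<le> k" "k \<le> n"
  shows "subalgebra (F k) (F j)"
  using assms by (auto simp: finite_filtration_def subalgebra_def)

lemma (in prob_space) supermartingale_real_cond_exp:
  assumes F: "finite_filtration M n F" and Y: "integrable M Y"
  shows "supermartingale M n F (\<lambda>k. real_cond_exp M (F k) Y)"
  unfolding supermartingale_def
proof (intro conjI allI impI)
  fix k assume "k \<le> n"
  then interpret sigma_finite_subalgebra M "F k"
    by (rule sigma_finite_subalgebra_filtration[OF F])
  show "integrable M (real_cond_exp M (F k) Y)"
    by (rule real_cond_exp_int(1)[OF Y])
next
  fix j k assume jk: "j \<le> k \<and> k \<le> n"
  then interpret sigma_finite_subalgebra M "F j"
    using sigma_finite_subalgebra_filtration[OF F, of j] by simp
  have "AE \<omega> in M. real_cond_exp M (F j) (real_cond_exp M (F k) Y) \<omega> = real_cond_exp M (F j) Y \<omega>"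
    using jk F subalgebra_filtration[OF F]
    by (intro real_cond_exp_nested_subalg Y) (auto simp: finite_filtration_def)
  then show "AE \<omega> in M. real_cond_exp M (F j) (real_cond_exp M (F k) Y) \<omega> \<le> real_cond_exp M (F j) Y \<omega>"
    by eventually_elim simp
qed simp

lemma (in prob_space) supermartingale_expectation_le:
  assumes F: "finite_filtration M n F" and X: "supermartingale M n F X" and "k \<le> n"
  shows "expectation (X k) \<le> expectation (X 0)"
proof -
  interpret sigma_finite_subalgebra M "F 0"
    by (rule sigma_finite_subalgebra_filtration[OF F]) simp
  have int: "integrable M (X k)" "integrable M (X 0)"
    using X \<open>k \<le> n\<close> by (auto simp: supermartingale_def)
  have "expectation (X k) = expectation (real_cond_exp M (F 0) (X k))"
    by (rule real_cond_exp_int(2)[OF int(1), symmetric])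
  also have "\<dots> \<le> expectation (X 0)"
    using X \<open>k \<le> n\<close> int by (intro integral_mono_AE real_cond_exp_int) (auto simp: supermartingale_def)
  finally show ?thesis .
qed

lemma (in prob_space) initial_value_ge:
  fixes S :: "nat \<Rightarrow> 'a \<Rightarrow> real"
  assumes F: "finite_filtration M n F" and X: "supermartingale M n F X"
    and c: "AE \<omega> in M. X 0 \<omega> = c" and "k \<le> n" and S: "integrable M (S k)"
    and loss: "ext_expectation M (\<lambda>\<omega>. max (- (X k \<omega> - S k \<omega>)) 0) \<le> ereal a"
  shows "expectation (S k) - a \<le> c"
proof -
  have int: "integrable M (X k)" "integrable M (X 0)"
    using X \<open>k \<le> n\<close> by (auto simp: supermartingale_def)
  have "expectation (S k) - expectation (X k) = expectation (\<lambda>\<omega>. S k \<omega> - X k \<omega>)"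
    using S int by simp
  also have "\<dots> \<le> expectation (\<lambda>\<omega>. max (- (X k \<omega> - S k \<omega>)) 0)"
    using S int by (intro integral_mono) auto
  \<comment> \<open>\<open>X k\<close> and \<open>S k\<close> are integrable, hence so is the loss,
    and the bound on its extended expectation becomes a bound on the Bochner integral.\<close>
  also have "\<dots> \<le> a"
    using loss S int by (subst (asm) ext_expectation_eq_integral) auto
  finally have "expectation (S k) - a \<le> expectation (X k)"
    by simp
  also have "\<dots> \<le> expectation (X 0)"
    by (rule supermartingale_expectation_le[OF F X \<open>k \<le> n\<close>])
  also have "\<dots> = expectation (\<lambda>_. c)"
    using c int by (intro integral_cong_AE) auto
  finally show ?thesis
    by (simp add: prob_space)
qed

section \<open>Construction of the optimal martingale\<close>

text \<open>The two alternatives are chosen so that \<open>S k\<close> minus the conditional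
  expectation of \<open>Y\<close> given \<open>F k\<close> has a known sign almost surely: its
  positive part is then either 0 or \<open>S k - Y\<close>.\<close>

lemma (in prob_space) exists_interpolating_variable:
  fixes S :: "nat \<Rightarrow> 'a \<Rightarrow> real"
  assumes F: "finite_filtration M n F"
    and meas: "\<And>k. k \<le> n \<Longrightarrow> S k \<in> borel_measurable (F k)"
    and int: "\<And>k. k \<le> n \<Longrightarrow> integrable M (S k)"
    and S0: "S 0 = (\<lambda>_. 0)"
    and mono: "AE \<omega> in M. mono_on {0..n} (\<lambda>k. S k \<omega>)"
    and c: "c \<le> expectation (S n)"
  obtains Y where "integrable M Y" "expectation Y = c"
    "\<And>k. k \<in> {1..n} \<Longrightarrow>
       (AE \<omega> in M. S k \<omega> \<le> Y \<omega>) \<or> (Y \<in> borel_measurable (F k) \<and> (AE \<omega> in M. Y \<omega> \<le> S k \<omega>))"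
\<comment> \<open>If \<open>n = 0\<close>, the bound on \<open>c\<close> reads
  \<open>c \<le> 0\<close>, so the constant variable serves here too. The other case starts from
  \<open>0 \<le> c\<close> and \<open>0 < n\<close>.\<close>
proof (cases "c < 0 \<or> n = 0")
  case True
  have c0: "c \<le> 0"
    using True c S0 by auto
  show thesis
  proof (rule that[of "\<lambda>_. c"])
    fix k assume "k \<in> {1..n}"
    have "AE \<omega> in M. c \<le> S k \<omega>"
      using mono
    proof eventually_elim
      case (elim \<omega>)
      have "S 0 \<omega> \<le> S k \<omega>"
        using elim \<open>k \<in> {1..n}\<close> by (auto intro: mono_onD)
      then show ?case
        using S0 c0 by simp
    qed
    then show "(AE \<omega> in M. S k \<omega> \<le> c) \<or>
        ((\<lambda>_. c) \<in> borel_measurable (F k) \<and> (AE \<omega> in M. c \<le> S k \<omega>))"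
      by simp
  qed (simp_all add: prob_space)
next
  case False
  define E where "E k = expectation (S k)" for k
  have "\<exists>j<n. E j \<le> c \<and> c \<le> E (Suc j)"
  proof (rule ccontr)
    assume neg: "\<not> ?thesis"
    \<comment> \<open>Discrete intermediate value argument: without a crossing,
      \<open>E k \<le> c\<close> forces \<open>E (Suc k) < c\<close>. At 0 only the weak inequality
      holds, but \<open>0 < n\<close> gives the strict one at \<open>n\<close>, against
      \<open>c \<le> E n\<close>.\<close>
    have "k \<le> n \<Longrightarrow> E k \<le> c \<and> (0 < k \<longrightarrow> E k < c)" for k
    proof (induction k)
      case 0
      then show ?case using False S0 by (simp add: E_def)
    next
      case (Suc k)
      then show ?case using neg by force
    qed
    from this[of n] show False
      using False c by (simp add: E_def)
  qed
  then obtain j where j: "j < n" "E j \<le> c" "c \<le> E (Suc j)"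
    by blast
  \<comment> \<open>\<open>t\<close> is the relative position of \<open>c\<close> between the two
    means; if these coincide, both equal \<open>c\<close> and any weight would do.\<close>
  obtain t where t: "0 \<le> t" "t \<le> 1" "c = (1 - t) * E j + t * E (Suc j)"
  proof (cases "E j = E (Suc j)")
    case True
    then show ?thesis using j by (intro that[of 0]) auto
  next
    case False
    define t where "t = (c - E j) / (E (Suc j) - E j)"
    have "t * (E (Suc j) - E j) = c - E j"
      using False by (simp add: t_def)
    moreover have "0 \<le> t" "t \<le> 1"
      using j False by (auto simp: t_def field_simps)
    ultimately show ?thesis
      by (intro that[of t]) (auto simp: algebra_simps)
  qed
  define Y where "Y \<omega> = (1 - t) * S j \<omega> + t * S (Suc j) \<omega>" for \<omega>
  have intj: "integrable M (S j)" "integrable M (S (Suc j))"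
    using j int by auto
  \<comment> \<open>Pathwise, \<open>Y\<close> lies between \<open>S j\<close> and
    \<open>S (Suc j)\<close>; monotonicity of the path extends this to all earlier and later
    times.\<close>
  have between: "AE \<omega> in M. (\<forall>k\<le>j. S k \<omega> \<le> Y \<omega>) \<and> (\<forall>k\<in>{Suc j..n}. Y \<omega> \<le> S k \<omega>)"
    using mono
  proof eventually_elim
    case (elim \<omega>)
    have m: "S a \<omega> \<le> S b \<omega>" if "a \<le> b" "b \<le> n" for a b
      using elim that by (auto intro: mono_onD)
    have "S j \<omega> \<le> S (Suc j) \<omega>"
      using m j by simp
    then have "S j \<omega> \<le> Y \<omega>" "Y \<omega> \<le> S (Suc j) \<omega>"
      using t mult_left_mono[of "S j \<omega>" "S (Suc j) \<omega>" t] mult_left_mono[of "S j \<omega>" "S (Suc j) \<omega>" "1 - t"]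
      by (auto simp: Y_def algebra_simps)
    then show ?case
      using m j by (meson Suc_leI atLeastAtMost_iff less_imp_le order_trans)
  qed
  show thesis
  proof (rule that[of Y])
    show "integrable M Y"
      unfolding Y_def using intj by simp
    show "expectation Y = c"
      unfolding Y_def using intj t by (simp add: E_def)
    fix k assume k: "k \<in> {1..n}"
    show "(AE \<omega> in M. S k \<omega> \<le> Y \<omega>) \<or> (Y \<in> borel_measurable (F k) \<and> (AE \<omega> in M. Y \<omega> \<le> S k \<omega>))"
    proof (cases "k \<le> j")
      case True
      have "AE \<omega> in M. S k \<omega> \<le> Y \<omega>"
        using between by eventually_elim (use True in auto)
      then show ?thesis ..
    next
      case False
      have "AE \<omega> in M. Y \<omega> \<le> S k \<omega>"
        using between by eventually_elim (use False k in auto)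
      \<comment> \<open>Here \<open>Suc j \<le> k\<close>, so both values that enter
        \<open>Y\<close> are known at time \<open>k\<close>.\<close>
      moreover have "S i \<in> borel_measurable (F k)" if "i \<le> k" for i
        using that k meas[of i] measurable_from_subalg[OF subalgebra_filtration[OF F]] by auto
      then have "Y \<in> borel_measurable (F k)"
        unfolding Y_def using False by simp
      ultimately show ?thesis by simp
    qed
  qed
qed

text \<open>If \<open>S \<le> Y\<close>, conditioning preserves the order and fixes
  \<open>S\<close>, so the shortfall vanishes and \<open>0 \<le> a\<close> suffices. If
  \<open>Y\<close> is \<open>G\<close>-measurable and \<open>Y \<le> S\<close>, conditioning fixes
  \<open>Y\<close>, and the expected shortfall is the difference of the means.\<close>

lemma (in prob_space) shortfall_real_cond_exp_le:
  fixes S :: "'a \<Rightarrow> real"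
  assumes G: "sigma_finite_subalgebra M G" and S: "S \<in> borel_measurable G" "integrable M S"
    and Y: "integrable M Y"
    and cases: "(AE \<omega> in M. S \<omega> \<le> Y \<omega>) \<or> (Y \<in> borel_measurable G \<and> (AE \<omega> in M. Y \<omega> \<le> S \<omega>))"
    and a: "0 \<le> a" "expectation S - expectation Y \<le> a"
  shows "ext_expectation M (\<lambda>\<omega>. max (- (real_cond_exp M G Y \<omega> - S \<omega>)) 0) \<le> ereal a"
proof -
  interpret sigma_finite_subalgebra M G by (rule G)
  have int: "integrable M (real_cond_exp M G Y)"
    by (rule real_cond_exp_int(1)[OF Y])
  have "expectation (\<lambda>\<omega>. max (- (real_cond_exp M G Y \<omega> - S \<omega>)) 0) \<le> a"
    using cases
  proof
    assume "AE \<omega> in M. S \<omega> \<le> Y \<omega>"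
    then have "AE \<omega> in M. real_cond_exp M G S \<omega> \<le> real_cond_exp M G Y \<omega>"
      by (intro real_cond_exp_mono S Y)
    moreover have "AE \<omega> in M. real_cond_exp M G S \<omega> = S \<omega>"
      by (intro real_cond_exp_F_meas S)
    ultimately have "AE \<omega> in M. max (- (real_cond_exp M G Y \<omega> - S \<omega>)) 0 = 0"
      by eventually_elim auto
    then have "expectation (\<lambda>\<omega>. max (- (real_cond_exp M G Y \<omega> - S \<omega>)) 0) = expectation (\<lambda>_. 0)"
      using int S by (intro integral_cong_AE) auto
    then show ?thesis using a by simp
  next
    assume *: "Y \<in> borel_measurable G \<and> (AE \<omega> in M. Y \<omega> \<le> S \<omega>)"
    then have "AE \<omega> in M. real_cond_exp M G Y \<omega> = Y \<omega>"
      by (intro real_cond_exp_F_meas Y) simp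
    then have "AE \<omega> in M. max (- (real_cond_exp M G Y \<omega> - S \<omega>)) 0 = S \<omega> - Y \<omega>"
      using conjunct2[OF *] by eventually_elim auto
    then have "expectation (\<lambda>\<omega>. max (- (real_cond_exp M G Y \<omega> - S \<omega>)) 0)
        = expectation (\<lambda>\<omega>. S \<omega> - Y \<omega>)"
      using int S Y by (intro integral_cong_AE) auto
    then show ?thesis using a S Y by simp
  qed
  then show ?thesis
    using int S by (subst ext_expectation_eq_integral) auto
qed

section \<open>The value as a maximum: attainment and optimality\<close>

theorem proposition11:
  fixes P Q :: "'a measure"
    and n :: nat
    and F :: "nat \<Rightarrow> 'a measure"
    and p S :: "nat \<Rightarrow> 'a \<Rightarrow> real"
    and l :: "real \<Rightarrow> real"
    and \<alpha> :: "nat \<Rightarrow> real"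
  assumes "prob_space P"
    and "prob_space Q"
    and "equivalent_measure P Q"
    and "n \<ge> 1"
    and "finite_filtration P n F"
    and "trivial_algebra P (F 0)"
    and "\<And>i. i \<in> {1..n} \<Longrightarrow> p i \<in> borel_measurable (F i)"
    and "\<And>i. i \<in> {1..n} \<Longrightarrow> integrable Q (p i)"
    and "S = cumulative p"
    and "l = (\<lambda>x. max (- x) 0)"
    and "P = Q"
    and "\<And>k. k \<in> {1..n} \<Longrightarrow> \<alpha> k \<ge> 0"
    and "AE \<omega> in P. mono_on {0..n} (\<lambda>k. S k \<omega>)"
  shows "V0_EU P Q n F l S \<alpha>
       = ereal (Max ((\<lambda>k. (\<integral>\<omega>. S k \<omega> \<partial>P) - \<alpha> k) ` {1..n}))"
proof -
  interpret prob_space P by fact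
  note F = \<open>finite_filtration P n F\<close>
  have sub: "subalgebra P (F k)" if "k \<le> n" for k
    using F that by (simp add: finite_filtration_def)
  have intp: "integrable P (p i)" if "i \<in> {1..n}" for i
    using assms(8)[OF that] \<open>P = Q\<close> by simp
  have S: "S k = (\<lambda>\<omega>. \<Sum>i=1..k. p i \<omega>)" for k
    using \<open>S = cumulative p\<close> by (auto simp: cumulative_def)
  have intS: "integrable P (S k)" if "k \<le> n" for k
    unfolding S using that intp by (intro Bochner_Integration.integrable_sum) auto
  have measS: "S k \<in> borel_measurable (F k)" if "k \<le> n" for k
    unfolding S
  proof (rule borel_measurable_sum)
    fix i assume "i \<in> {1..k}"
    then show "p i \<in> borel_measurable (F k)"
      using that assms(7)[of i] measurable_from_subalg[OF subalgebra_filtration[OF F]] by auto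
  qed
  define c where "c = Max ((\<lambda>k. expectation (S k) - \<alpha> k) ` {1..n})"
  have c_ge: "expectation (S k) - \<alpha> k \<le> c" if "k \<in> {1..n}" for k
    unfolding c_def using that by (intro Max_ge) auto
  have "c \<in> (\<lambda>k. expectation (S k) - \<alpha> k) ` {1..n}"
    unfolding c_def using \<open>n \<ge> 1\<close> by (intro Max_in) auto
  then obtain m where m: "m \<in> {1..n}" "c = expectation (S m) - \<alpha> m"
    by blast
  \<comment> \<open>Together with \<open>\<alpha> m \<ge> 0\<close> this gives
    \<open>c \<le> expectation (S n)\<close>, the condition under which the interpolating variable
    exists.\<close>
  have "expectation (S m) \<le> expectation (S n)"
  proof (intro integral_mono_AE intS)
    show "AE \<omega> in P. S m \<omega> \<le> S n \<omega>"
      using assms(13) by eventually_elim (use m in \<open>auto intro: mono_onD\<close>)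
  qed (use m in auto)
  then have "c \<le> expectation (S n)"
    using m assms(12)[of m] by simp
  then obtain Y where Y: "integrable P Y" "expectation Y = c" and YS: "\<And>k. k \<in> {1..n} \<Longrightarrow>
      (AE \<omega> in P. S k \<omega> \<le> Y \<omega>) \<or> (Y \<in> borel_measurable (F k) \<and> (AE \<omega> in P. Y \<omega> \<le> S k \<omega>))"
    using exists_interpolating_variable[of n F S c] F measS intS assms(13) by (auto simp: S)
  define X where "X k = real_cond_exp P (F k) Y" for k
  have "supermartingale P n F X"
    using supermartingale_real_cond_exp[OF F Y(1)] by (simp add: X_def[abs_def])
  moreover have "AE \<omega> in P. X 0 \<omega> = c"
  proof -
    interpret F0: sigma_finite_subalgebra P "F 0"
      by (rule sigma_finite_subalgebra_filtration[OF F]) simp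
    \<comment> \<open>Triviality of \<open>F 0\<close> makes \<open>X 0\<close> almost surely
      constant, and conditioning keeps the mean \<open>c\<close> of \<open>Y\<close>.\<close>
    have "AE \<omega> in P. X 0 \<omega> = expectation (X 0)"
      unfolding X_def
      by (intro AE_eq_expectation_of_trivial[OF sub assms(6)] F0.real_cond_exp_int(1) Y) simp_all
    then show ?thesis
      using F0.real_cond_exp_int(2)[OF Y(1)] Y(2) by (simp add: X_def)
  qed
  moreover have "ext_expectation P (\<lambda>\<omega>. l (X k \<omega> - S k \<omega>)) \<le> ereal (\<alpha> k)" if k: "k \<in> {1..n}" for k
    unfolding \<open>l = _\<close> X_def
    using k c_ge[OF k] Y(2) assms(12)[OF k]
    by (intro shortfall_real_cond_exp_le sigma_finite_subalgebra_filtration[OF F] measS intS Y YS) auto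
  ultimately have "V0_EU P Q n F l S \<alpha> \<le> ereal c"
    unfolding V0_EU_def \<open>P = Q\<close>[symmetric] by (intro Inf_lower) blast
  moreover have "ereal c \<le> V0_EU P Q n F l S \<alpha>"
    unfolding V0_EU_def \<open>P = Q\<close>[symmetric]
  proof (rule Inf_greatest, clarify)
    fix b X
    assume "supermartingale P n F X" "AE \<omega> in P. X 0 \<omega> = b"
      and "\<forall>k\<in>{1..n}. ext_expectation P (\<lambda>\<omega>. l (X k \<omega> - S k \<omega>)) \<le> ereal (\<alpha> k)"
    \<comment> \<open>The constraint at the maximizing time \<open>m\<close> already forces the
      bound.\<close>
    then have "expectation (S m) - \<alpha> m \<le> b"
      using m(1) intS[of m] unfolding \<open>l = _\<close>
      by (intro initial_value_ge[OF F]) auto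
    then show "ereal c \<le> ereal b"
      using m(2) by simp
  qed
  ultimately show ?thesis
    unfolding c_def by (rule antisym)
qed

end
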